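(* The ideal $I(Q,q)=\mathbb F_2[Q_{n,0},\ldots,Q_{n,n-1}]\cap\langle V_1^q,\ldots,V_n^q\rangle$ is not in general the ideal of the ring $\mathbb F_2[Q_{n,0},\ldots,Q_{n,n-1}]$ generated by the monomials of degree $q$ in $Q_{n,0},\ldots,Q_{n,n-1}$. For example, this fails for $n=2$ and $q=3$, and for $n=2$ and $q=4$.
   Context: $\mathbb F_2[V_1,\ldots,V_n]$ is a polynomial ring in $n$ variables and $\langle V_1^q,\ldots,V_n^q\rangle$ is the ideal of it generated by the $q$-th powers of the variables. The elements $Q_{n,r}\in\mathbb F_2[V_1,\ldots,V_n]$, $0\le r\le n-1$ (Dickson invariants), are defined recursively by $Q_{n,r}=Q_{n-1,r}V_n+Q_{n-1,r-1}^2$ for $n\ge 2$, with $Q_{1,0}=V_1$ and the conventions $Q_{k,k}=1$, $Q_{k,-1}=0$ for $k\ge1$. For instance $Q_{2,0}=V_1V_2$ and $Q_{2,1}=V_2+V_1^2$. $\mathbb F_2[Q_{n,0},\ldots,Q_{n,n-1}]$ is the subring generated by these elements. The degree of a monomial in $Q_{n,0},\ldots,Q_{n,n-1}$ is its total degree as a monomial in these symbols (each $Q_{n,r}$ counted with degree 1). *)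

theory Defs
  imports
    "HOL-Library.Poly_Mapping"
    "HOL-Library.Z2"
    "HOL-Algebra.Generated_Rings"
    "HOL-Algebra.Ideal"
begin

text \<open>Polynomials over the two-element field \<^typ>\<open>bit\<close> in countably many variables, as finitely
  supported functions from exponent vectors to coefficients; finitely many variables are
  singled out by the carrier of \<open>poly_ring\<close> below.\<close>

type_synonym f2_poly = "(nat \<Rightarrow>\<^sub>0 nat) \<Rightarrow>\<^sub>0 bit"

definition V :: "nat \<Rightarrow> f2_poly"
  where "V i = Poly_Mapping.single (Poly_Mapping.single i 1) 1"

text \<open>The ring of polynomials in \<open>V 1, \<dots>, V n\<close>: every exponent vector that occurs is supported
  on \<open>{1..n}\<close>.\<close>

definition poly_ring :: "nat \<Rightarrow> f2_poly ring"
  where "poly_ring n =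
    \<lparr> carrier = {p. \<forall>m \<in> Poly_Mapping.keys p. Poly_Mapping.keys m \<subseteq> {1..n}},
      mult = (*), one = 1, zero = 0, add = (+) \<rparr>"

text \<open>The second index is an integer so that the conventions \<open>Q k k = 1\<close> and \<open>Q k (- 1) = 0\<close> can
  be stated literally. The values at first index \<open>0\<close>, and those at second index
  outside \<open>{- 1..n}\<close>, are junk that the recursion never reaches from \<open>0 \<le> r < n\<close>.\<close>

fun Q :: "nat \<Rightarrow> int \<Rightarrow> f2_poly"
  where
    "Q 0 r = 0"
  | "Q (Suc 0) r = (if r = 0 then V 1 else if r = 1 then 1 else 0)"
  | "Q (Suc (Suc k)) r =
      (if r = int (k + 2) then 1
       else if 0 \<le> r \<and> r < int (k + 2)
         then Q (Suc k) r * V (k + 2) + (Q (Suc k) (r - 1))\<^sup>2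
       else 0)"

definition dickson_set :: "nat \<Rightarrow> f2_poly set"
  where "dickson_set n = {Q n (int r) | r. r < n}"

definition dickson_ring :: "nat \<Rightarrow> f2_poly ring"
  where "dickson_ring n = (poly_ring n)\<lparr>carrier := generate_ring (poly_ring n) (dickson_set n)\<rparr>"

definition power_ideal :: "nat \<Rightarrow> nat \<Rightarrow> f2_poly set"
  where "power_ideal n q = Idl\<^bsub>poly_ring n\<^esub> {V i ^ q | i. i \<in> {1..n}}"

definition dickson_power_ideal :: "nat \<Rightarrow> nat \<Rightarrow> f2_poly set"
  where "dickson_power_ideal n q = carrier (dickson_ring n) \<inter> power_ideal n q"

definition dickson_monomials :: "nat \<Rightarrow> nat \<Rightarrow> f2_poly set"
  where "dickson_monomials n q =
    {(\<Prod>r<n. Q n (int r) ^ e r) | e :: nat \<Rightarrow> nat. (\<Sum>r<n. e r) = q}"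

text \<open>The generated ideals above are taken in genuine commutative rings and their generators lie
  in these rings, so that \<^const>\<open>genideal\<close> has its intended meaning.\<close>

lemma poly_ring_simps [simp]:
  "mult (poly_ring n) = (*)" "one (poly_ring n) = 1"
  "zero (poly_ring n) = 0" "add (poly_ring n) = (+)"
  by (simp_all add: poly_ring_def)

lemma cring_poly_ring: "cring (poly_ring n)"
proof (rule cringI)
  let ?P = "carrier (poly_ring n)"
  have add: "p + q \<in> ?P" if "p \<in> ?P" "q \<in> ?P" for p q
    using that Poly_Mapping.keys_add[of p q] by (fastforce simp: poly_ring_def)
  have mult: "p * q \<in> ?P" if "p \<in> ?P" "q \<in> ?P" for p q
  proof -
    have "Poly_Mapping.keys m \<subseteq> {1..n}" if m: "m \<in> Poly_Mapping.keys (p * q)" for m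
    proof -
      obtain a b where "m = a + b" "a \<in> Poly_Mapping.keys p" "b \<in> Poly_Mapping.keys q"
        using m Poly_Mapping.keys_mult[of p q] by blast
      then show ?thesis
        using \<open>p \<in> ?P\<close> \<open>q \<in> ?P\<close> Poly_Mapping.keys_add[of a b]
        by (fastforce simp: poly_ring_def)
    qed
    then show ?thesis by (simp add: poly_ring_def)
  qed
  have one: "1 \<in> ?P" and zero: "0 \<in> ?P"
    by (simp_all add: poly_ring_def flip: single_one)
  have neg: "- p \<in> ?P" if "p \<in> ?P" for p
    using that by (simp add: poly_ring_def)
  show "abelian_group (poly_ring n)"
  proof (rule abelian_groupI)
    show "\<exists>y\<in>?P. y \<oplus>\<^bsub>poly_ring n\<^esub> x = \<zero>\<^bsub>poly_ring n\<^esub>" if "x \<in> ?P" for x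
      using neg[OF that] by (intro bexI[of _ "- x"]) simp_all
  qed (use add zero in \<open>simp_all add: algebra_simps\<close>)
  show "comm_monoid (poly_ring n)"
    by (rule comm_monoidI) (use mult one in \<open>simp_all add: algebra_simps\<close>)
qed (simp add: algebra_simps)

lemma V_in_poly_ring: "i \<in> {1..n} \<Longrightarrow> V i \<in> carrier (poly_ring n)"
  by (simp add: poly_ring_def V_def)

lemma poly_ring_mono: "m \<le> n \<Longrightarrow> carrier (poly_ring m) \<subseteq> carrier (poly_ring n)"
  by (fastforce simp: poly_ring_def)

lemma power_in_poly_ring: "p \<in> carrier (poly_ring n) \<Longrightarrow> p ^ k \<in> carrier (poly_ring n)"
proof (induction k)
  case 0
  then show ?case using monoid.one_closed[of "poly_ring n"] cring_poly_ring[of n]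
    by (auto simp: cring_def ring_def)
next
  case (Suc k)
  then show ?case
    using monoid.m_closed[of "poly_ring n" p "p ^ k"] cring_poly_ring[of n]
    by (auto simp: cring_def ring_def)
qed

lemma Q_in_poly_ring: "Q n r \<in> carrier (poly_ring n)"
proof (induction n r rule: Q.induct)
  case (1 r)
  then show ?case by (simp add: poly_ring_def)
next
  case (2 r)
  interpret cring "poly_ring (Suc 0)" by (rule cring_poly_ring)
  show ?case using V_in_poly_ring[of 1 "Suc 0"] one_closed zero_closed by simp
next
  case (3 k r)
  interpret cring "poly_ring (Suc (Suc k))" by (rule cring_poly_ring)
  have mono: "carrier (poly_ring (Suc k)) \<subseteq> carrier (poly_ring (Suc (Suc k)))"
    by (rule poly_ring_mono) simp
  show ?case
  proof (cases "r \<noteq> int (k + 2) \<and> 0 \<le> r \<and> r < int (k + 2)")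
    case True
    then have "Q (Suc k) r \<in> carrier (poly_ring (Suc (Suc k)))"
      and "Q (Suc k) (r - 1) \<in> carrier (poly_ring (Suc (Suc k)))"
      using 3 mono by auto
    moreover have "V (k + 2) \<in> carrier (poly_ring (Suc (Suc k)))"
      by (rule V_in_poly_ring) simp
    ultimately show ?thesis
      using True a_closed m_closed power_in_poly_ring by simp
  next
    case False
    then show ?thesis using one_closed zero_closed by auto
  qed
qed

lemma Q_2: "Q 2 0 = V 1 * V 2" "Q 2 1 = V 2 + (V 1)\<^sup>2"
  by (simp_all add: numeral_2_eq_2)

lemma dickson_set_subset: "dickson_set n \<subseteq> carrier (poly_ring n)"
  by (auto simp: dickson_set_def Q_in_poly_ring)

lemma subring_dickson_ring: "subring (carrier (dickson_ring n)) (poly_ring n)"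
  using ring.generate_ring_is_subring[OF cring.axioms(1)[OF cring_poly_ring] dickson_set_subset]
  by (simp add: dickson_ring_def)

lemma dickson_ring_simps [simp]:
  "mult (dickson_ring n) = (*)" "one (dickson_ring n) = 1"
  "zero (dickson_ring n) = 0" "add (dickson_ring n) = (+)"
  by (simp_all add: dickson_ring_def)

lemma cring_dickson_ring: "cring (dickson_ring n)"
proof -
  interpret P: cring "poly_ring n" by (rule cring_poly_ring)
  show ?thesis
    using P.subcring_iff[of "carrier (dickson_ring n)"] P.subcringI'[OF subring_dickson_ring]
      subringE(1)[OF subring_dickson_ring]
    by (simp add: dickson_ring_def)
qed

lemma dickson_monomials_subset: "dickson_monomials n q \<subseteq> carrier (dickson_ring n)"
proof -
  interpret D: cring "dickson_ring n" by (rule cring_dickson_ring)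
  have pow: "x ^ k \<in> carrier (dickson_ring n)" if "x \<in> carrier (dickson_ring n)" for x k
    using that D.one_closed D.m_closed by (induction k) auto
  have gen: "Q n (int r) \<in> carrier (dickson_ring n)" if "r < n" for r
    using that by (auto simp: dickson_ring_def dickson_set_def intro: generate_ring.incl)
  have "(\<Prod>r<k. Q n (int r) ^ e r) \<in> carrier (dickson_ring n)" if "k \<le> n" for k e
    using that
  proof (induction k)
    case (Suc k)
    then have "(\<Prod>r<k. Q n (int r) ^ e r) \<in> carrier (dickson_ring n)"
      and "Q n (int k) ^ e k \<in> carrier (dickson_ring n)"
      using pow gen by auto
    from D.m_closed[OF this] show ?case by simp
  qed (use D.one_closed in simp)
  then show ?thesis by (auto simp: dickson_monomials_def)
qed

lemma ideal_power_ideal: "ideal (power_ideal n q) (poly_ring n)"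
  unfolding power_ideal_def
  by (rule ring.genideal_ideal[OF cring.axioms(1)[OF cring_poly_ring]])
    (auto intro!: power_in_poly_ring V_in_poly_ring)

lemma ideal_dickson_power_ideal: "ideal (dickson_power_ideal n q) (dickson_ring n)"
proof -
  interpret P: ideal "power_ideal n q" "poly_ring n" by (rule ideal_power_ideal)
  interpret D: cring "dickson_ring n" by (rule cring_dickson_ring)
  have sub: "carrier (dickson_ring n) \<subseteq> carrier (poly_ring n)"
    by (rule subringE(1)[OF subring_dickson_ring])
  have neg: "\<ominus>\<^bsub>poly_ring n\<^esub> x = - x" if "x \<in> carrier (poly_ring n)" for x
    using P.l_neg[OF that] by (simp add: eq_neg_iff_add_eq_0)
  have neg': "\<ominus>\<^bsub>dickson_ring n\<^esub> x = - x" if "x \<in> carrier (dickson_ring n)" for x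
    using D.l_neg[OF that] by (simp add: eq_neg_iff_add_eq_0)
  show ?thesis
  proof (rule idealI[OF D.ring_axioms])
    show "subgroup (dickson_power_ideal n q) (add_monoid (dickson_ring n))"
    proof (rule D.add.subgroupI)
      show "dickson_power_ideal n q \<noteq> {}"
        using D.zero_closed additive_subgroup.zero_closed[OF P.additive_subgroup_axioms]
        by (auto simp: dickson_power_ideal_def)
    next
      fix a assume a: "a \<in> dickson_power_ideal n q"
      then have "- a \<in> dickson_power_ideal n q"
        using sub neg[of a] neg'[of a] D.a_inv_closed[of a]
          P.I_l_closed[of a "- 1"] neg[OF P.one_closed] P.a_inv_closed[OF P.one_closed]
        by (auto simp: dickson_power_ideal_def)
      then show "\<ominus>\<^bsub>dickson_ring n\<^esub> a \<in> dickson_power_ideal n q"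
        using a neg'[of a] by (simp add: dickson_power_ideal_def)
    next
      fix a b assume "a \<in> dickson_power_ideal n q" "b \<in> dickson_power_ideal n q"
      then show "a \<oplus>\<^bsub>dickson_ring n\<^esub> b \<in> dickson_power_ideal n q"
        using D.a_closed[of a b] additive_subgroup.a_closed[OF P.additive_subgroup_axioms, of a b]
        by (auto simp: dickson_power_ideal_def)
    qed (auto simp: dickson_power_ideal_def)
  next
    fix a x assume "a \<in> dickson_power_ideal n q" "x \<in> carrier (dickson_ring n)"
    then show "x \<otimes>\<^bsub>dickson_ring n\<^esub> a \<in> dickson_power_ideal n q"
      and "a \<otimes>\<^bsub>dickson_ring n\<^esub> x \<in> dickson_power_ideal n q"
      using sub D.m_closed[of a x] D.m_closed[of x a] P.I_l_closed[of a x] P.I_r_closed[of a x]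
      by (auto simp: dickson_power_ideal_def)
  qed
qed

end

theory Submission
  imports Defs
begin

text \<open>
  Write \<open>x\<close>, \<open>y\<close> for the two variables, \<open>A = x y\<close> and \<open>B = y + x\<^sup>2\<close> for the two Dickson
  invariants. The equality fails because some monomials of degree \<open>q\<close> in \<open>A\<close>, \<open>B\<close> do not even
  lie in \<open>\<langle>x\<^sup>q, y\<^sup>q\<rangle>\<close>. Membership in \<open>\<langle>x\<^sup>q, y\<^sup>q\<rangle>\<close> forces the coefficient of every
  monomial with all exponents below \<open>q\<close> to vanish (\<open>power_ideal_lookup_eq_0\<close>). But expanding
  \<open>B\<^sup>3 = y\<^sup>3 + 3 x\<^sup>2 y\<^sup>2 + 3 x\<^sup>4 y + x\<^sup>6\<close>, where \<open>3 = 1\<close>, shows that \<open>B\<^sup>3\<close> has the term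
  \<open>x\<^sup>2 y\<^sup>2\<close>, an obstruction for \<open>q = 3\<close>, and that \<open>A B\<^sup>3\<close> has the term \<open>x\<^sup>3 y\<^sup>3\<close>, an
  obstruction for \<open>q = 4\<close>. (In the latter case \<open>B\<^sup>4 = y\<^sup>4 + x\<^sup>8\<close> itself does lie in the
  ideal, so the factor \<open>A\<close> is needed.)
\<close>

lemma V_power: "V i ^ k = Poly_Mapping.single (Poly_Mapping.single i k) 1"
  by (induction k) (simp_all add: V_def mult_single flip: single_add)

text \<open>The polynomials without a monomial whose exponents are all below \<open>q\<close> form an ideal, since
  a factor of such a monomial is again such a monomial; this ideal contains the generators.\<close>

lemma power_ideal_lookup_eq_0:
  assumes p: "p \<in> power_ideal n q" and m: "\<And>i. Poly_Mapping.lookup m i < q"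
  shows "Poly_Mapping.lookup p m = 0"
proof -
  interpret R: cring "poly_ring n" by (rule cring_poly_ring)
  define S where "S = {p \<in> carrier (poly_ring n).
    \<forall>m \<in> Poly_Mapping.keys p. \<exists>i. q \<le> Poly_Mapping.lookup m i}"
  have mult: "a * b \<in> S" if "a \<in> S" "b \<in> carrier (poly_ring n)" for a b
  proof -
    have "\<exists>i. q \<le> Poly_Mapping.lookup m i" if m: "m \<in> Poly_Mapping.keys (a * b)" for m
    proof -
      obtain k l where "m = k + l" "k \<in> Poly_Mapping.keys a"
        using m Poly_Mapping.keys_mult[of a b] by blast
      then show ?thesis using \<open>a \<in> S\<close> by (force simp: S_def lookup_add intro: trans_le_add1)
    qed
    then show ?thesis using that R.m_closed[of a b] by (auto simp: S_def)
  qed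
  have "ideal S (poly_ring n)"
  proof (rule idealI[OF R.ring_axioms])
    show "subgroup S (add_monoid (poly_ring n))"
    proof (rule R.add.subgroupI)
      show "S \<noteq> {}" using R.zero_closed by (auto simp: S_def)
    next
      fix a assume a: "a \<in> S"
      then have "\<ominus>\<^bsub>poly_ring n\<^esub> a = a * (\<ominus>\<^bsub>poly_ring n\<^esub> 1)"
        using R.r_minus[of a 1] R.one_closed by (simp add: S_def)
      then show "\<ominus>\<^bsub>poly_ring n\<^esub> a \<in> S"
        using mult[OF a R.a_inv_closed[OF R.one_closed]] by simp
    next
      fix a b assume "a \<in> S" "b \<in> S"
      then show "a \<oplus>\<^bsub>poly_ring n\<^esub> b \<in> S"
        using R.a_closed[of a b] Poly_Mapping.keys_add[of a b] by (fastforce simp: S_def)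
    qed (auto simp: S_def)
  next
    fix a x assume "a \<in> S" "x \<in> carrier (poly_ring n)"
    then show "x \<otimes>\<^bsub>poly_ring n\<^esub> a \<in> S" "a \<otimes>\<^bsub>poly_ring n\<^esub> x \<in> S"
      using mult[of a x] by (simp_all add: mult.commute)
  qed
  moreover have "{V i ^ q | i. i \<in> {1..n}} \<subseteq> S"
  proof
    fix p assume "p \<in> {V i ^ q | i. i \<in> {1..n}}"
    then obtain i where i: "i \<in> {1..n}" and p: "p = V i ^ q" by blast
    have "p \<in> carrier (poly_ring n)"
      unfolding p by (rule power_in_poly_ring[OF V_in_poly_ring[OF i]])
    moreover have "q \<le> Poly_Mapping.lookup m i" if "m \<in> Poly_Mapping.keys p" for m
      using that by (simp add: p V_power)
    ultimately show "p \<in> S" by (auto simp: S_def)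
  qed
  ultimately have "power_ideal n q \<subseteq> S"
    unfolding power_ideal_def by (rule R.genideal_minimal)
  then have "m \<notin> Poly_Mapping.keys p"
    using p m by (auto simp: S_def simp flip: not_less)
  then show ?thesis by (simp add: in_keys_iff)
qed

lemma lookup_V1_V2:
  "Poly_Mapping.lookup (V 1 ^ a * V 2 ^ b) (Poly_Mapping.single 1 c + Poly_Mapping.single 2 d)
     = (if a = c \<and> b = d then 1 else 0)"
proof -
  have "Poly_Mapping.single 1 a + Poly_Mapping.single 2 b
      = Poly_Mapping.single 1 c + Poly_Mapping.single (2::nat) d \<longleftrightarrow> a = c \<and> b = d"
    (is "?l = ?r \<longleftrightarrow> _")
  proof
    assume eq: "?l = ?r"
    show "a = c \<and> b = d"
      using arg_cong[OF eq, of "\<lambda>m. Poly_Mapping.lookup m 1"]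
        arg_cong[OF eq, of "\<lambda>m. Poly_Mapping.lookup m 2"]
      by (simp add: lookup_add lookup_single)
  qed simp
  then show ?thesis by (simp add: V_power mult_single lookup_single)
qed

text \<open>The two obstructions at once: \<open>j = 0\<close> gives \<open>B\<^sup>3\<close> and \<open>j = 1\<close> gives \<open>A B\<^sup>3\<close>.\<close>

lemma lookup_Q_2:
  "Poly_Mapping.lookup (Q 2 0 ^ j * Q 2 1 ^ 3)
     (Poly_Mapping.single 1 (j + 2) + Poly_Mapping.single 2 (j + 2)) = 1"
proof -
  \<comment> \<open>The binomial coefficient 3 is kept as a threefold sum, so that it is evaluated in \<open>bit\<close>
    after taking coefficients.\<close>
  have "(V 1 * V 2) ^ j * (V 2 + (V 1)\<^sup>2) ^ 3
      = V 1 ^ j * V 2 ^ (j + 3)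
      + (V 1 ^ (j + 2) * V 2 ^ (j + 2) + V 1 ^ (j + 2) * V 2 ^ (j + 2)
         + V 1 ^ (j + 2) * V 2 ^ (j + 2))
      + (V 1 ^ (j + 4) * V 2 ^ (j + 1) + V 1 ^ (j + 4) * V 2 ^ (j + 1)
         + V 1 ^ (j + 4) * V 2 ^ (j + 1))
      + V 1 ^ (j + 6) * V 2 ^ j"
    by (simp add: power_mult_distrib power_add eval_nat_numeral algebra_simps)
  then show ?thesis
    unfolding Q_2 by (simp only: lookup_add lookup_V1_V2) simp
qed

lemma dickson_monomial_2: "Q 2 0 ^ a * Q 2 1 ^ b \<in> dickson_monomials 2 (a + b)"
proof -
  let ?e = "\<lambda>r::nat. if r = 0 then a else b"
  have "Q 2 0 ^ a * Q 2 1 ^ b = (\<Prod>r<2. Q 2 (int r) ^ ?e r)" "(\<Sum>r<2. ?e r) = a + b"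
    by (simp_all add: lessThan_nat_numeral lessThan_Suc mult.commute)
  then show ?thesis unfolding dickson_monomials_def by (intro CollectI exI[of _ ?e] conjI)
qed

lemma dickson_power_ideal_2_neq:
  assumes "j + 3 = q"
  shows "dickson_power_ideal 2 q \<noteq> Idl\<^bsub>dickson_ring 2\<^esub> (dickson_monomials 2 q)"
proof
  interpret D: cring "dickson_ring 2" by (rule cring_dickson_ring)
  assume eq: "dickson_power_ideal 2 q = Idl\<^bsub>dickson_ring 2\<^esub> (dickson_monomials 2 q)"
  let ?p = "Q 2 0 ^ j * Q 2 1 ^ 3"
  let ?m = "Poly_Mapping.single 1 (j + 2) + Poly_Mapping.single (2::nat) (j + 2)"
  have "?p \<in> Idl\<^bsub>dickson_ring 2\<^esub> (dickson_monomials 2 q)"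
    using D.genideal_self[OF dickson_monomials_subset] dickson_monomial_2[of j 3] assms by auto
  then have "?p \<in> power_ideal 2 q"
    unfolding eq[symmetric] dickson_power_ideal_def by blast
  moreover have "Poly_Mapping.lookup ?m i < q" for i
    using assms by (auto simp: lookup_add lookup_single when_def)
  ultimately have "Poly_Mapping.lookup ?p ?m = 0"
    by (rule power_ideal_lookup_eq_0)
  then show False using lookup_Q_2[of j] by simp
qed

theorem claim4p5:
  shows "\<not> (\<forall>n\<ge>1. \<forall>q\<ge>1.
            dickson_power_ideal n q = Idl\<^bsub>dickson_ring n\<^esub> (dickson_monomials n q))
       \<and> dickson_power_ideal 2 3 \<noteq> Idl\<^bsub>dickson_ring 2\<^esub> (dickson_monomials 2 3)
       \<and> dickson_power_ideal 2 4 \<noteq> Idl\<^bsub>dickson_ring 2\<^esub> (dickson_monomials 2 4)"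
proof -
  have "dickson_power_ideal 2 3 \<noteq> Idl\<^bsub>dickson_ring 2\<^esub> (dickson_monomials 2 3)"
    by (rule dickson_power_ideal_2_neq[of 0]) simp
  moreover have "dickson_power_ideal 2 4 \<noteq> Idl\<^bsub>dickson_ring 2\<^esub> (dickson_monomials 2 4)"
    by (rule dickson_power_ideal_2_neq[of 1]) simp
  moreover have "(1::nat) \<le> 2" "(1::nat) \<le> 3" by simp_all
  ultimately show ?thesis by blast
qed

end
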